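(* Let $\alpha,\beta$ be real numbers with $\alpha<-1<\beta$. Then the inclusions $$\mathsf{pdBW}_{\alpha}\subset\mathsf{pdBW}\supset\mathsf{pdBW}_{\beta}$$ are proper, i.e. $\mathsf{pdBW}_\alpha\ne\mathsf{pdBW}$ and $\mathsf{pdBW}_\beta\neq\mathsf{pdBW}$.
   Context: A balancedly weighted vector space ($\mathsf{BW}$ space) $(X,\|\cdot\|)$ is a real topological vector space $X$ with a continuous map $\|\cdot\|:X\to[0,\infty)$ (the weight) such that $\|r\cdot\vec x\|=|r|\cdot\|\vec x\|$ for all $r\in\mathbb{R}$, $\vec x\in X$. The triangle inequality is not assumed. It is positive definite if $\|\vec x\|=0$ holds only for $\vec x=\vec 0$. Let $\mathsf{pdBW}$ be the class of all positive definite $\mathsf{BW}$ spaces. Let $(X,\|\cdot\|)\in\mathsf{pdBW}$ and $\varrho\in\mathbb{R}$. For $\vec x,\vec y\in X\setminus\{\vec 0\}$ put $\mathbf{s}=\left\|\frac{\vec x}{\|\vec x\|}+\frac{\vec y}{\|\vec y\|}\right\|$, $\mathbf{d}=\left\|\frac{\vec x}{\|\vec x\|}-\frac{\vec y}{\|\vec y\|}\right\|$, $\mathbf{\Sigma}=\mathbf{s}^2+\mathbf{d}^2$ (which is $>0$), $\mathbf{\Delta}=\mathbf{s}^2-\mathbf{d}^2$, and $\langle\vec x\,|\,\vec y\rangle_\varrho=\|\vec x\|\cdot\|\vec y\|\cdot\frac14\mathbf{\Delta}\cdot\left(\frac14\mathbf{\Sigma}\right)^{\varrho}$; put $\langle\vec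 x\,|\,\vec y\rangle_\varrho=0$ if $\vec x=\vec 0$ or $\vec y=\vec 0$. The space $(X,\|\cdot\|)$ "has the angle $\angle_\varrho$" if $|\langle\vec x\,|\,\vec y\rangle_\varrho|\le\|\vec x\|\cdot\|\vec y\|$ for all $\vec x,\vec y\in X$, i.e. if the angle $\angle_\varrho(\vec x,\vec y):=\arccos\frac{\langle\vec x|\vec y\rangle_\varrho}{\|\vec x\|\|\vec y\|}$ is defined for all $\vec x,\vec y\ne\vec 0$. Let $\mathsf{pdBW}_\varrho$ be the class of all $(X,\|\cdot\|)\in\mathsf{pdBW}$ that have the angle $\angle_\varrho$. *)

theory Defs
  imports "HOL-Analysis.Analysis" "HOL-Algebra.Algebraic_Closure_Type"
begin

(* HOL-Algebra has vector spaces as modules over a field; here the field is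
   ring_of_type_algebra :: real ring, i.e. the reals as a record. The fields mult and one
   that the module record inherits from the ring record play no role. *)

record 'a weighted_space = "(real, 'a) module" +
  vtopology :: "'a topology"
  weight :: "'a \<Rightarrow> real"

locale real_tvs = module "ring_of_type_algebra :: real ring" V
  for V :: "('a, 'm) weighted_space_scheme" (structure) +
  assumes topspace_eq: "topspace (vtopology V) = carrier V"
    and continuous_add:
      "continuous_map (prod_topology (vtopology V) (vtopology V)) (vtopology V)
         (\<lambda>(x, y). x \<oplus>\<^bsub>V\<^esub> y)"
    and continuous_smult:
      "continuous_map (prod_topology euclideanreal (vtopology V)) (vtopology V)
         (\<lambda>(r, x). r \<odot>\<^bsub>V\<^esub> x)"

locale bw_space = real_tvs V
  for V :: "('a, 'm) weighted_space_scheme" (structure) +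
  assumes continuous_weight: "continuous_map (vtopology V) (top_of_set {0..}) (weight V)"
    and weight_smult:
      "x \<in> carrier V \<Longrightarrow> weight V (r \<odot>\<^bsub>V\<^esub> x) = \<bar>r\<bar> * weight V x"

locale pd_bw_space = bw_space V
  for V :: "('a, 'm) weighted_space_scheme" (structure) +
  assumes positive_definite: "\<lbrakk>x \<in> carrier V; weight V x = 0\<rbrakk> \<Longrightarrow> x = \<zero>\<^bsub>V\<^esub>"

definition normalize_vec :: "('a, 'm) weighted_space_scheme \<Rightarrow> 'a \<Rightarrow> 'a" where
  "normalize_vec V x = (1 / weight V x) \<odot>\<^bsub>V\<^esub> x"

definition s_val :: "('a, 'm) weighted_space_scheme \<Rightarrow> 'a \<Rightarrow> 'a \<Rightarrow> real" where
  "s_val V x y = weight V (normalize_vec V x \<oplus>\<^bsub>V\<^esub> normalize_vec V y)"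

definition d_val :: "('a, 'm) weighted_space_scheme \<Rightarrow> 'a \<Rightarrow> 'a \<Rightarrow> real" where
  "d_val V x y = weight V (normalize_vec V x \<ominus>\<^bsub>V\<^esub> normalize_vec V y)"

definition Sigma_val :: "('a, 'm) weighted_space_scheme \<Rightarrow> 'a \<Rightarrow> 'a \<Rightarrow> real" where
  "Sigma_val V x y = (s_val V x y)\<^sup>2 + (d_val V x y)\<^sup>2"

definition Delta_val :: "('a, 'm) weighted_space_scheme \<Rightarrow> 'a \<Rightarrow> 'a \<Rightarrow> real" where
  "Delta_val V x y = (s_val V x y)\<^sup>2 - (d_val V x y)\<^sup>2"

definition angle_product ::
    "('a, 'm) weighted_space_scheme \<Rightarrow> real \<Rightarrow> 'a \<Rightarrow> 'a \<Rightarrow> real" where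
  "angle_product V \<rho> x y =
     (if x = \<zero>\<^bsub>V\<^esub> \<or> y = \<zero>\<^bsub>V\<^esub> then 0
      else weight V x * weight V y * (1 / 4 * Delta_val V x y)
             * (1 / 4 * Sigma_val V x y) powr \<rho>)"

definition has_angle :: "('a, 'm) weighted_space_scheme \<Rightarrow> real \<Rightarrow> bool" where
  "has_angle V \<rho> \<longleftrightarrow>
     (\<forall>x\<in>carrier V. \<forall>y\<in>carrier V. \<bar>angle_product V \<rho> x y\<bar> \<le> weight V x * weight V y)"

(* The classes of spaces are rendered as sets of all the spaces whose carrier is a
   set of elements of a given type 'a. *)

definition pdBW :: "'a weighted_space set" where
  "pdBW = {V. pd_bw_space V}"

definition pdBW_angle :: "real \<Rightarrow> 'a weighted_space set" where
  "pdBW_angle \<rho> = {V \<in> pdBW. has_angle V \<rho>}"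

end

theory Submission
  imports Defs
begin

text \<open>
  The triangle inequality is not available, so the weights \<open>s\<close> and \<open>d\<close> of the sum and of the
  difference of two unit vectors can be any two positive numbers. On the plane, let both basis
  vectors have weight \<open>1\<close>, and let the weight interpolate linearly along the unit square from
  \<open>1\<close> to \<open>s\<close> on the diagonal and to \<open>d\<close> on the antidiagonal. This weight (\<open>plane_weight s d\<close>) is
  continuous, balanced and, for \<open>s, d > 0\<close>, positive definite.

  For \<open>s = 3 * t\<close> and \<open>d = t\<close> the quantity whose modulus has to be at most \<open>1\<close> is
  \<open>\<Delta>/4 * (\<Sigma>/4) powr \<rho> = (4/5) * u powr (1 + \<rho>)\<close> with \<open>u = (5/2) * t\<^sup>2\<close>. If \<open>\<rho> \<noteq> -1\<close>, then
  \<open>u powr (1 + \<rho>)\<close> takes every positive value, for example \<open>2\<close>, which violates the bound. The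
  case \<open>\<rho> < -1\<close> uses small \<open>u\<close> and the case \<open>\<rho> > -1\<close> large \<open>u\<close>, but the witness
  \<open>u = 2 powr (1 / (1 + \<rho>))\<close> covers both.

  The space has to live on a type that is only known to have at least as many elements as the
  real line. As \<open>\<real> \<times> \<real>\<close> and \<open>\<real>\<close> are equinumerous, the plane embeds into this type, and all of
  its structure is carried over to the image of the embedding.
\<close>

section \<open>Weighted spaces carried over along an injection\<close>

definition transported_space ::
    "('b::real_normed_vector \<Rightarrow> 'a) \<Rightarrow> ('b \<Rightarrow> real) \<Rightarrow> 'a weighted_space" where
  "transported_space f w =
     \<lparr>carrier = range f, monoid.mult = (\<lambda>x y. undefined), one = undefined,
      ring.zero = f 0, add = (\<lambda>x y. f (the_inv f x + the_inv f y)),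
      smult = (\<lambda>r x. f (r *\<^sub>R the_inv f x)),
      vtopology = pullback_topology (range f) (the_inv f) euclidean,
      weight = (\<lambda>x. w (the_inv f x))\<rparr>"

lemma transported_space_simps:
  assumes "inj f"
  shows "carrier (transported_space f w) = range f"
    and "\<zero>\<^bsub>transported_space f w\<^esub> = f 0"
    and "f u \<oplus>\<^bsub>transported_space f w\<^esub> f v = f (u + v)"
    and "r \<odot>\<^bsub>transported_space f w\<^esub> f u = f (r *\<^sub>R u)"
    and "weight (transported_space f w) (f u) = w u"
  using assms by (simp_all add: transported_space_def the_inv_f_f)

lemma module_transported_space:
  assumes "inj f"
  shows "module (ring_of_type_algebra :: real ring) (transported_space f w)"
proof (rule moduleI)
  show "cring (ring_of_type_algebra :: real ring)" ..
  show "abelian_group (transported_space f w)"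
  proof (rule abelian_groupI)
    fix x assume "x \<in> carrier (transported_space f w)"
    then obtain u where "x = f u"
      by (auto simp: transported_space_simps[OF assms])
    then have "f (- u) \<oplus>\<^bsub>transported_space f w\<^esub> x = \<zero>\<^bsub>transported_space f w\<^esub>"
      by (simp add: transported_space_simps[OF assms])
    then show "\<exists>y\<in>carrier (transported_space f w).
        y \<oplus>\<^bsub>transported_space f w\<^esub> x = \<zero>\<^bsub>transported_space f w\<^esub>"
      by (auto simp: transported_space_simps[OF assms])
  qed (auto simp: transported_space_simps[OF assms] add_ac)
qed (auto simp: transported_space_simps[OF assms] ring_of_type_algebra_def algebra_simps)

lemma minus_transported_space:
  assumes "inj f"
  shows "f u \<ominus>\<^bsub>transported_space f w\<^esub> f v = f (u - v)"
proof -
  interpret module "ring_of_type_algebra :: real ring" "transported_space f w"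
    by (rule module_transported_space[OF assms])
  have "\<ominus>\<^bsub>transported_space f w\<^esub> f v = f (- v)"
    by (rule M.minus_equality) (auto simp: transported_space_simps[OF assms])
  then show ?thesis
    by (simp add: a_minus_def transported_space_simps[OF assms])
qed

lemma pd_bw_space_transported_space:
  fixes f :: "'b::real_normed_vector \<Rightarrow> 'a"
  assumes inj: "inj f"
    and cont: "continuous_on UNIV w"
    and nonneg: "\<And>u. 0 \<le> w u"
    and homogeneous: "\<And>r u. w (r *\<^sub>R u) = \<bar>r\<bar> * w u"
    and definite: "\<And>u. w u = 0 \<Longrightarrow> u = 0"
  shows "pd_bw_space (transported_space f w)"
proof -
  let ?V = "transported_space f w"
  let ?T = "pullback_topology (range f) (the_inv f) euclidean"
  have top: "vtopology ?V = ?T"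
    by (simp add: transported_space_def)
  have space: "topspace ?T = range f"
    by (simp add: topspace_pullback_topology)
  have coord: "continuous_map ?T euclidean (the_inv f)"
    using continuous_map_pullback[of euclidean euclidean id] by simp
  have into: "continuous_map S ?T (\<lambda>z. f (g z))" if "continuous_map S euclidean g" for S g
    using that inj by (intro continuous_map_pullback') (auto simp: o_def the_inv_f_f)
  interpret module "ring_of_type_algebra :: real ring" ?V
    by (rule module_transported_space[OF inj])
  show ?thesis
  proof unfold_locales
    show "topspace (vtopology ?V) = carrier ?V"
      by (simp add: top space transported_space_simps[OF inj])
  next
    have "continuous_map (prod_topology ?T ?T) euclidean
        (\<lambda>z. the_inv f (fst z) + the_inv f (snd z))"
      by (intro continuous_map_add continuous_map_compose[OF _ coord, unfolded o_def]
          continuous_map_fst continuous_map_snd)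
    from into[OF this]
    show "continuous_map (prod_topology (vtopology ?V) (vtopology ?V)) (vtopology ?V)
        (\<lambda>(x, y). x \<oplus>\<^bsub>?V\<^esub> y)"
      by (simp add: top case_prod_unfold) (simp add: transported_space_def)
  next
    have "continuous_map (prod_topology euclideanreal ?T) euclidean
        (\<lambda>z. fst z *\<^sub>R the_inv f (snd z))"
    proof -
      have "continuous_map (prod_topology euclideanreal ?T) euclidean
          (\<lambda>z. (fst z, the_inv f (snd z)))"
        unfolding prod_topology_euclidean[symmetric]
        by (intro continuous_map_pairedI continuous_map_fst
            continuous_map_compose[OF continuous_map_snd coord, unfolded o_def])
      moreover have "continuous_map euclidean euclidean (\<lambda>z::real \<times> 'b. fst z *\<^sub>R snd z)"
        by (simp add: continuous_intros)
      ultimately have "continuous_map (prod_topology euclideanreal ?T) euclidean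
          ((\<lambda>z. fst z *\<^sub>R snd z) \<circ> (\<lambda>z. (fst z, the_inv f (snd z))))"
        by (rule continuous_map_compose)
      then show ?thesis
        by (simp only: o_def fst_conv snd_conv)
    qed
    from into[OF this]
    show "continuous_map (prod_topology euclideanreal (vtopology ?V)) (vtopology ?V)
        (\<lambda>(r, x). r \<odot>\<^bsub>?V\<^esub> x)"
      by (simp add: top case_prod_unfold) (simp add: transported_space_def)
  next
    have "continuous_map ?T euclideanreal (w \<circ> the_inv f)"
      using coord cont by (intro continuous_map_compose) auto
    then show "continuous_map (vtopology ?V) (top_of_set {0..}) (weight ?V)"
      unfolding top
      by (simp add: continuous_map_in_subtopology transported_space_def o_def nonneg
          image_subset_iff Pi_iff)
  qed (auto simp: transported_space_simps[OF inj] homogeneous dest: definite)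
qed

section \<open>A plane with prescribed diagonal weights\<close>

text \<open>
  The expression \<open>(\<bar>a + b\<bar> - \<bar>a - b\<bar>) / 2\<close> is \<open>min \<bar>a\<bar> \<bar>b\<bar>\<close> with the sign of \<open>a * b\<close>, so only
  the weight \<open>s\<close> counts where \<open>a\<close> and \<open>b\<close> have equal signs, and only \<open>d\<close> where their signs are
  opposite. The first summand vanishes exactly on the two diagonals.
\<close>

definition plane_weight :: "real \<Rightarrow> real \<Rightarrow> real \<times> real \<Rightarrow> real" where
  "plane_weight s d = (\<lambda>(a, b). \<bar>\<bar>a\<bar> - \<bar>b\<bar>\<bar>
     + s * max 0 ((\<bar>a + b\<bar> - \<bar>a - b\<bar>) / 2) + d * max 0 ((\<bar>a - b\<bar> - \<bar>a + b\<bar>) / 2))"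

lemma continuous_on_plane_weight: "continuous_on UNIV (plane_weight s d)"
  unfolding plane_weight_def case_prod_unfold by (intro continuous_intros) auto

lemma plane_weight_nonneg:
  assumes "s \<ge> 0" "d \<ge> 0"
  shows "0 \<le> plane_weight s d u"
  using assms by (auto simp: plane_weight_def case_prod_unfold)

lemma plane_weight_scaleR: "plane_weight s d (r *\<^sub>R u) = \<bar>r\<bar> * plane_weight s d u"
proof -
  obtain a b where u: "u = (a, b)" by (cases u)
  have scale_max: "max 0 (\<bar>r\<bar> * c) = \<bar>r\<bar> * max 0 c" for c :: real
    by (auto simp: max_def zero_le_mult_iff mult_le_0_iff)
  have scale_diff: "\<bar>\<bar>r\<bar> * x - \<bar>r\<bar> * y\<bar> = \<bar>r\<bar> * \<bar>x - y\<bar>" for x y :: real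
    by (simp add: abs_mult flip: right_diff_distrib)
  have scale_half: "(\<bar>r\<bar> * x - \<bar>r\<bar> * y) / 2 = \<bar>r\<bar> * ((x - y) / 2)" for x y :: real
    by (simp add: algebra_simps)
  have "\<bar>r * a + r * b\<bar> = \<bar>r\<bar> * \<bar>a + b\<bar>" "\<bar>r * a - r * b\<bar> = \<bar>r\<bar> * \<bar>a - b\<bar>"
    by (simp_all flip: abs_mult add: algebra_simps)
  then show ?thesis
    by (simp only: u plane_weight_def prod.case scaleR_Pair real_scaleR_def abs_mult
        scale_half scale_max scale_diff)
      (simp add: algebra_simps)
qed

lemma plane_weight_definite:
  assumes "s > 0" "d > 0" and zero: "plane_weight s d u = 0"
  shows "u = 0"
proof -
  obtain a b where u: "u = (a, b)" by (cases u)
  define p where "p = max 0 ((\<bar>a + b\<bar> - \<bar>a - b\<bar>) / 2)"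
  define q where "q = max 0 ((\<bar>a - b\<bar> - \<bar>a + b\<bar>) / 2)"
  have "\<bar>\<bar>a\<bar> - \<bar>b\<bar>\<bar> + s * p + d * q = 0"
    using zero by (simp add: u plane_weight_def p_def q_def)
  moreover have "0 \<le> s * p" "0 \<le> d * q"
    using assms by (simp_all add: p_def q_def)
  ultimately have "\<bar>a\<bar> = \<bar>b\<bar>" "s * p = 0" "d * q = 0"
    by linarith+
  then have "\<bar>a\<bar> = \<bar>b\<bar>" "p = 0" "q = 0"
    using assms by auto
  then have "\<bar>a\<bar> = \<bar>b\<bar>" "\<bar>a + b\<bar> = \<bar>a - b\<bar>"
    by (simp_all add: p_def q_def max_def split: if_splits)
  then have "a = 0 \<and> b = 0" by linarith
  then show ?thesis by (simp add: u zero_prod_def)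
qed

text \<open>
  The transported basis vectors \<open>f (1, 0)\<close> and \<open>f (0, 1)\<close> have the prescribed \<open>s\<close> and \<open>d\<close>, which
  turns the condition of having the angle into a condition on two arbitrary positive numbers.
\<close>

lemma has_angle_transported_plane:
  fixes f :: "real \<times> real \<Rightarrow> 'a"
  assumes inj: "inj f"
    and angle: "has_angle (transported_space f (plane_weight s d)) \<rho>"
  shows "\<bar>1 / 4 * (s\<^sup>2 - d\<^sup>2) * (1 / 4 * (s\<^sup>2 + d\<^sup>2)) powr \<rho>\<bar> \<le> 1"
proof -
  let ?V = "transported_space f (plane_weight s d)"
  let ?x = "f (1, 0)" and ?y = "f (0, 1)"
  note simps = transported_space_simps[OF inj] minus_transported_space[OF inj]
  have weights: "weight ?V ?x = 1" "weight ?V ?y = 1"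
    by (simp_all add: simps plane_weight_def)
  then have normalized: "normalize_vec ?V ?x = ?x" "normalize_vec ?V ?y = ?y"
    by (simp_all add: normalize_vec_def simps)
  have sd: "s_val ?V ?x ?y = s" "d_val ?V ?x ?y = d"
    by (simp_all add: s_val_def d_val_def normalized simps)
      (simp_all add: plane_weight_def)
  have "?x \<noteq> \<zero>\<^bsub>?V\<^esub>" "?y \<noteq> \<zero>\<^bsub>?V\<^esub>"
    using inj by (simp_all add: simps inj_eq zero_prod_def)
  then have "angle_product ?V \<rho> ?x ?y
      = 1 / 4 * (s\<^sup>2 - d\<^sup>2) * (1 / 4 * (s\<^sup>2 + d\<^sup>2)) powr \<rho>"
    by (simp add: angle_product_def Delta_val_def Sigma_val_def weights sd)
  moreover have "\<bar>angle_product ?V \<rho> ?x ?y\<bar> \<le> weight ?V ?x * weight ?V ?y"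
    using angle unfolding has_angle_def by (simp add: simps(1))
  ultimately show ?thesis
    by (simp only: weights mult_1)
qed

section \<open>Failure of the angle\<close>

lemma diagonal_weights_violating_angle_bound:
  fixes \<rho> :: real
  assumes "\<rho> \<noteq> -1"
  obtains s d :: real where "s > 0" "d > 0"
    "1 / 4 * (s\<^sup>2 - d\<^sup>2) * (1 / 4 * (s\<^sup>2 + d\<^sup>2)) powr \<rho> > 1"
proof -
  define u :: real where "u = 2 powr (1 / (1 + \<rho>))"
  define t where "t = sqrt (2 / 5 * u)"
  have "u > 0" by (simp add: u_def)
  then have "t > 0" and t2: "t\<^sup>2 = 2 / 5 * u" by (simp_all add: t_def)
  have "u * u powr \<rho> = u powr (1 + \<rho>)"
    using \<open>u > 0\<close> by (simp add: powr_add)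
  also have "\<dots> = 2"
    using assms by (simp add: u_def powr_powr)
  finally have "u * u powr \<rho> = 2" .
  moreover have "1 / 4 * ((3 * t)\<^sup>2 - t\<^sup>2) = 4 / 5 * u" "1 / 4 * ((3 * t)\<^sup>2 + t\<^sup>2) = u"
    by (simp_all add: power_mult_distrib t2)
  ultimately have "1 / 4 * ((3 * t)\<^sup>2 - t\<^sup>2) * (1 / 4 * ((3 * t)\<^sup>2 + t\<^sup>2)) powr \<rho> > 1"
    by (simp only: mult.assoc)
  with \<open>t > 0\<close> show thesis
    by (intro that[of "3 * t" t]) auto
qed

lemma plane_lepoll:
  assumes "(UNIV :: real set) \<lesssim> A"
  shows "(UNIV :: (real \<times> real) set) \<lesssim> A"
proof -
  have "(card_of ((UNIV :: real set) \<times> (UNIV :: real set)), card_of (UNIV :: real set)) \<in> ordIso"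
    by (rule card_of_Times_same_infinite) (rule infinite_UNIV_char_0)
  then have "(UNIV :: (real \<times> real) set) \<approx> (UNIV :: real set)"
    by (simp add: eqpoll_iff_card_of_ordIso)
  then show ?thesis
    using assms by (rule lepoll_trans1)
qed

lemma pdBW_angle_psubset_pdBW:
  assumes "(UNIV :: real set) \<lesssim> (UNIV :: 'a set)" and "\<rho> \<noteq> -1"
  shows "(pdBW_angle \<rho> :: 'a weighted_space set) \<subset> pdBW"
proof -
  obtain f :: "real \<times> real \<Rightarrow> 'a" where "inj f"
    using plane_lepoll[OF assms(1)] by (auto simp: lepoll_def)
  obtain s d :: real where "s > 0" "d > 0"
    and violation: "1 / 4 * (s\<^sup>2 - d\<^sup>2) * (1 / 4 * (s\<^sup>2 + d\<^sup>2)) powr \<rho> > 1"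
    using diagonal_weights_violating_angle_bound[OF assms(2)] .
  let ?V = "transported_space f (plane_weight s d)"
  have "pd_bw_space ?V"
    using \<open>inj f\<close> \<open>s > 0\<close> \<open>d > 0\<close>
    by (intro pd_bw_space_transported_space continuous_on_plane_weight plane_weight_nonneg
        plane_weight_scaleR plane_weight_definite) auto
  moreover have "\<not> has_angle ?V \<rho>"
    using has_angle_transported_plane[OF \<open>inj f\<close>, of s d \<rho>] violation by linarith
  ultimately show ?thesis
    by (auto simp: pdBW_def pdBW_angle_def)
qed

theorem proposition10:
  fixes \<alpha> \<beta> :: real
  assumes "(UNIV :: real set) \<lesssim> (UNIV :: 'a set)"
    and "\<alpha> < -1" and "-1 < \<beta>"
  shows "(pdBW_angle \<alpha> :: 'a weighted_space set) \<subset> pdBW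
    \<and> (pdBW_angle \<beta> :: 'a weighted_space set) \<subset> pdBW"
  using assms(2,3) pdBW_angle_psubset_pdBW[OF assms(1)] by simp

end
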